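(* The Multiobjective Spanner (MSp) problem is intractable even when restricted to instances whose graph is degree-3 bounded and outerplanar. That is, there is no algorithm that, for every such instance $I$, outputs the non-dominated set $\mathcal{Y}_N$ of $I$ in time bounded by a polynomial in the size of $I$.
   Context: MSp: the input is a connected, undirected graph $G=(V,E)$ with edge-weight functions $c_1\colon E\to\mathbb{Z}$ and $c_2\colon E\to\mathbb{N}_+$. A feasible solution (spanner) is a set $S\subseteq E$ such that $(V,S)$ is connected. Each spanner $S$ has value vector $f(S)=(f_1(S),f_2(S))^\mathsf{T}$ with $f_1(S)=\sum_{e\in S}c_1(e)$ and $f_2(S)=\max_{u,v\in V,\,u\neq v}\frac{d^S_{c_2}(u,v)}{d^E_{c_2}(u,v)}$, where $d^F_{c_2}(u,v)$ is the length of a shortest $u$-$v$-path using only edges of $F$ with respect to lengths $c_2$. For value vectors $y\neq y'$, $y$ is dominated by $y'$ if $y'\le y$ componentwise. The non-dominated set $\mathcal{Y}_N$ is the set of value vectors of spanners that are not dominated by the value vector of any spanner; solving an instance means outputting $\mathcal{Y}_N$. A graph is degree-3 bounded if every vertex has degree at most 3, and outerplanar if it has a drawing with all vertices on the boundary of the outer face. *)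

theory Defs
  imports "HOL-Analysis.Analysis" "HOL-Computational_Algebra.Polynomial"
begin

section \<open>Graphs and spanners\<close>

definition simple_graph :: "'v set \<Rightarrow> 'v set set \<Rightarrow> bool" where
  "simple_graph V E \<longleftrightarrow> finite V \<and> (\<forall>e\<in>E. e \<subseteq> V \<and> card e = 2)"

definition walk_edges :: "'v list \<Rightarrow> 'v set list" where
  "walk_edges xs = map (\<lambda>(x, y). {x, y}) (zip xs (tl xs))"

definition upath :: "'v set set \<Rightarrow> 'v \<Rightarrow> 'v \<Rightarrow> 'v list \<Rightarrow> bool" where
  "upath F u v xs \<longleftrightarrow> xs \<noteq> [] \<and> hd xs = u \<and> last xs = v \<and> distinct xs \<and>
     set (walk_edges xs) \<subseteq> F"

definition graph_connected :: "'v set \<Rightarrow> 'v set set \<Rightarrow> bool" where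
  "graph_connected V F \<longleftrightarrow> V \<noteq> {} \<and> (\<forall>u\<in>V. \<forall>v\<in>V. \<exists>xs. upath F u v xs)"

definition degree_bounded :: "nat \<Rightarrow> 'v set \<Rightarrow> 'v set set \<Rightarrow> bool" where
  "degree_bounded k V E \<longleftrightarrow> (\<forall>v\<in>V. card {e \<in> E. v \<in> e} \<le> k)"

text \<open>Meaningful only if some path from \<open>u\<close> to \<open>v\<close> uses edges of \<open>F\<close> only; otherwise the
  infimum is taken over the empty set and has the value 0.\<close>

definition sp_dist :: "('v set \<Rightarrow> nat) \<Rightarrow> 'v set set \<Rightarrow> 'v \<Rightarrow> 'v \<Rightarrow> nat" where
  "sp_dist c F u v = Inf {sum_list (map c (walk_edges xs)) | xs. upath F u v xs}"

record 'v msp =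
  verts :: "'v set"
  edges :: "'v set set"
  cost1 :: "'v set \<Rightarrow> int"
  cost2 :: "'v set \<Rightarrow> nat"

text \<open>Two vertices are required because the stretch \<open>f\<^sub>2\<close> of a one-vertex graph would be the
  maximum of an empty set.\<close>

definition msp_instance :: "'v msp \<Rightarrow> bool" where
  "msp_instance I \<longleftrightarrow> simple_graph (verts I) (edges I) \<and> graph_connected (verts I) (edges I) \<and>
     card (verts I) \<ge> 2 \<and> (\<forall>e\<in>edges I. cost2 I e > 0)"

definition spanner :: "'v msp \<Rightarrow> 'v set set \<Rightarrow> bool" where
  "spanner I S \<longleftrightarrow> S \<subseteq> edges I \<and> graph_connected (verts I) S"

definition f1 :: "'v msp \<Rightarrow> 'v set set \<Rightarrow> int" where
  "f1 I S = (\<Sum>e\<in>S. cost1 I e)"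

definition f2 :: "'v msp \<Rightarrow> 'v set set \<Rightarrow> rat" where
  "f2 I S = Max {of_nat (sp_dist (cost2 I) S u v) / of_nat (sp_dist (cost2 I) (edges I) u v)
     | u v. u \<in> verts I \<and> v \<in> verts I \<and> u \<noteq> v}"

definition value_vector :: "'v msp \<Rightarrow> 'v set set \<Rightarrow> int \<times> rat" where
  "value_vector I S = (f1 I S, f2 I S)"

definition dominated_by :: "int \<times> rat \<Rightarrow> int \<times> rat \<Rightarrow> bool" where
  "dominated_by y y' \<longleftrightarrow> y \<noteq> y' \<and> fst y' \<le> fst y \<and> snd y' \<le> snd y"

definition nondominated_set :: "'v msp \<Rightarrow> (int \<times> rat) set" where
  "nondominated_set I = {value_vector I S | S. spanner I S \<and>
     \<not> (\<exists>S'. spanner I S' \<and> dominated_by (value_vector I S) (value_vector I S'))}"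

section \<open>Outerplanarity\<close>

definition plane_drawing ::
  "'v set \<Rightarrow> 'v set set \<Rightarrow> ('v \<Rightarrow> complex) \<Rightarrow> ('v set \<Rightarrow> real \<Rightarrow> complex) \<Rightarrow> bool" where
  "plane_drawing V E pos crv \<longleftrightarrow> inj_on pos V \<and>
     (\<forall>e\<in>E. arc (crv e) \<and> {pathstart (crv e), pathfinish (crv e)} = pos ` e \<and>
        path_image (crv e) \<inter> pos ` V = pos ` e) \<and>
     (\<forall>e\<in>E. \<forall>e'\<in>E. e \<noteq> e' \<longrightarrow> path_image (crv e) \<inter> path_image (crv e') \<subseteq> pos ` (e \<inter> e'))"

definition drawing_image ::
  "'v set \<Rightarrow> 'v set set \<Rightarrow> ('v \<Rightarrow> complex) \<Rightarrow> ('v set \<Rightarrow> real \<Rightarrow> complex) \<Rightarrow> complex set" where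
  "drawing_image V E pos crv = pos ` V \<union> (\<Union>e\<in>E. path_image (crv e))"

text \<open>The complement of the compact set drawn has exactly one unbounded component, the outer face;
  \<^const>\<open>outside\<close> is the union of all unbounded components.\<close>

definition outerplanar :: "'v set \<Rightarrow> 'v set set \<Rightarrow> bool" where
  "outerplanar V E \<longleftrightarrow> (\<exists>pos crv. plane_drawing V E pos crv \<and>
     (\<forall>v\<in>V. pos v \<in> frontier (outside (drawing_image V E pos crv))))"

section \<open>Turing machines\<close>

text \<open>Algorithms are deterministic one-tape machines with a two-way infinite tape. Inputs and outputs
  are words over the symbols other than \<open>Blank\<close> and \<open>Aux k\<close>; a machine may use any finite number
  of the auxiliary symbols. The start state is 0, and an undefined transition means halting.\<close>

datatype symb = Blank | Digit bool | Minus | Comma | Semicolon | Aux nat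

datatype move = MLeft | MStay | MRight

record tm =
  states :: "nat set"
  alphabet :: "symb set"
  delta :: "nat \<Rightarrow> symb \<Rightarrow> (nat \<times> symb \<times> move) option"

definition turing_machine :: "tm \<Rightarrow> bool" where
  "turing_machine M \<longleftrightarrow> finite (states M) \<and> 0 \<in> states M \<and> finite (alphabet M) \<and>
     {Blank, Digit False, Digit True, Minus, Comma, Semicolon} \<subseteq> alphabet M \<and>
     (\<forall>q\<in>states M. \<forall>s\<in>alphabet M. \<forall>q' s' m. delta M q s = Some (q', s', m) \<longrightarrow>
        q' \<in> states M \<and> s' \<in> alphabet M)"

text \<open>State, head position and tape contents.\<close>

type_synonym config = "nat \<times> int \<times> (int \<Rightarrow> symb)"

fun offset :: "move \<Rightarrow> int" where
  "offset MLeft = - 1"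
| "offset MStay = 0"
| "offset MRight = 1"

fun halted :: "tm \<Rightarrow> config \<Rightarrow> bool" where
  "halted M (q, h, T) \<longleftrightarrow> delta M q (T h) = None"

fun step :: "tm \<Rightarrow> config \<Rightarrow> config" where
  "step M (q, h, T) = (case delta M q (T h) of
      None \<Rightarrow> (q, h, T)
    | Some (q', s, m) \<Rightarrow> (q', h + offset m, T(h := s)))"

definition init_config :: "symb list \<Rightarrow> config" where
  "init_config w = (0, 0, \<lambda>i. if 0 \<le> i \<and> i < int (length w) then w ! nat i else Blank)"

text \<open>The output is the word read from cell 0 to the right up to the first blank.\<close>

fun shows_output :: "config \<Rightarrow> symb list \<Rightarrow> bool" where
  "shows_output (q, h, T) w \<longleftrightarrow>
     Blank \<notin> set w \<and> (\<forall>i<length w. T (int i) = w ! i) \<and> T (int (length w)) = Blank"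

text \<open>Halted configurations are fixed points of \<^const>\<open>step\<close>, so this says that the machine stops
  after at most \<open>t\<close> steps.\<close>

definition outputs_within :: "tm \<Rightarrow> symb list \<Rightarrow> nat \<Rightarrow> symb list \<Rightarrow> bool" where
  "outputs_within M w t w' \<longleftrightarrow>
     (let c = (step M ^^ t) (init_config w) in halted M c \<and> shows_output c w')"

section \<open>Encodings\<close>

text \<open>All numbers are written in binary, most significant digit first.\<close>

fun enc_nat :: "nat \<Rightarrow> symb list" where
  "enc_nat n = (if n < 2 then [Digit (odd n)] else enc_nat (n div 2) @ [Digit (odd n)])"

declare enc_nat.simps [simp del]

definition enc_int :: "int \<Rightarrow> symb list" where
  "enc_int i = (if i < 0 then [Minus] else []) @ enc_nat (nat \<bar>i\<bar>)"

definition enc_instance :: "nat msp \<Rightarrow> symb list" where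
  "enc_instance I = (let vs = sorted_list_of_set (verts I) in
     concat [enc_nat v @ [Comma]. v \<leftarrow> vs] @ [Semicolon] @
     concat [enc_nat u @ [Comma] @ enc_nat v @ [Comma] @ enc_int (cost1 I {u, v}) @ [Comma] @
         enc_nat (cost2 I {u, v}) @ [Semicolon].
       u \<leftarrow> vs, v \<leftarrow> vs, u < v \<and> {u, v} \<in> edges I])"

definition instance_size :: "nat msp \<Rightarrow> nat" where
  "instance_size I = length (enc_instance I)"

text \<open>A value vector is output as \<open>(a, n, d)\<close> with second component the fraction \<open>n / d\<close>, which need
  not be in lowest terms.\<close>

definition enc_vectors :: "(int \<times> nat \<times> nat) list \<Rightarrow> symb list" where
  "enc_vectors ys =
     concat [enc_int a @ [Comma] @ enc_nat n @ [Comma] @ enc_nat d @ [Semicolon]. (a, n, d) \<leftarrow> ys]"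

definition lists_vectors :: "(int \<times> nat \<times> nat) list \<Rightarrow> (int \<times> rat) set \<Rightarrow> bool" where
  "lists_vectors ys Y \<longleftrightarrow> (\<forall>(a, n, d)\<in>set ys. d > 0) \<and>
     (\<lambda>(a, n, d). (a, of_nat n / of_nat d)) ` set ys = Y"

definition solves_within :: "tm \<Rightarrow> nat msp \<Rightarrow> nat \<Rightarrow> bool" where
  "solves_within M I t \<longleftrightarrow> (\<exists>ys. lists_vectors ys (nondominated_set I) \<and>
     outputs_within M (enc_instance I) t (enc_vectors ys))"

end

(* Take a path 0, 1, ..., 3n - 1 with chords {3i, 3i + 2} for i < n and a closing edge {0, 3n - 1}
   of length 1 and cost 2^n. Chord i has cost 2^i, all other edges are free, and the lengths are such
   that the detour around chord i is longer than the chord by 2^(i+1). In a spanner without the closing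
   edge, the stretch of the pair (0, 3n - 1) exceeds a constant by twice what is saved by omitting
   chords, and it is the maximum stretch if only chords are omitted. Hence all 2^n choices of chords
   give distinct non-dominated values, while a Turing machine writes at most one cell per step. *)

theory Submission
  imports Defs "HOL-Library.Nat_Bijection"
begin

section \<open>Walks and distances\<close>

text \<open>Write w(X) for the sum of 2^i over i in X, which is \<open>set_encode X\<close>. This
  line has negative slope, so its points do not dominate each other, and no spanner without the
  closing edge lies below it, even one that lacks path edges. A spanner with the closing edge costs
  at least 2^n, more than all chords together, so it dominates none of these points. The obstacle is
  that \<open>f2\<close> is a maximum over all pairs. The pair (0, 3n - 1) attains it because every
  other pair has distance at least 2 in the full graph, while omitting chords leaves all distances
  at most 5 * 2^n - 6, less than twice 3 * 2^n - 4. Costs and lengths are exponential in n but have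
  O(n) binary digits, so the instance has size cubic in n.\<close>

lemma walk_edges_simps [simp]:
  "walk_edges [] = []"
  "walk_edges [x] = []"
  "walk_edges (x # y # zs) = {x, y} # walk_edges (y # zs)"
  by (simp_all add: walk_edges_def)

lemma walk_edges_append:
  assumes "xs \<noteq> []" "ys \<noteq> []"
  shows "walk_edges (xs @ ys) = walk_edges xs @ {last xs, hd ys} # walk_edges ys"
  using assms(1)
proof (induction xs rule: list_nonempty_induct)
  case (single x)
  then show ?case using assms(2) by (cases ys) auto
next
  case (cons x xs)
  then show ?case by (cases xs) auto
qed

lemma walk_edges_rev: "walk_edges (rev xs) = rev (walk_edges xs)"
proof (induction xs)
  case (Cons x xs)
  note IH = Cons.IH
  show ?case
  proof (cases xs)
    case (Cons y ys)
    have "walk_edges (rev xs @ [x]) = walk_edges (rev xs) @ [{last (rev xs), x}]"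
      using Cons by (subst walk_edges_append) auto
    then show ?thesis
      using IH Cons by (simp add: insert_commute del: rev.simps(2)) simp
  qed simp
qed simp

lemma walk_edges_upt: "walk_edges [u..<Suc v] = map (\<lambda>k. {k, Suc k}) [u..<v]"
proof (induction v)
  case (Suc v)
  show ?case
  proof (cases "u \<le> v")
    case True
    then have "walk_edges ([u..<Suc v] @ [Suc v]) = walk_edges [u..<Suc v] @ [{v, Suc v}]"
      by (subst walk_edges_append) auto
    then show ?thesis using Suc True by simp
  qed (auto simp: not_le Suc_le_eq)
qed simp

lemma upath_rev: "upath F u v xs \<Longrightarrow> upath F v u (rev xs)"
  by (auto simp: upath_def walk_edges_rev hd_rev last_rev)

lemma upath_upt:
  assumes "u \<le> v" "\<And>k. u \<le> k \<Longrightarrow> k < v \<Longrightarrow> {k, Suc k} \<in> F"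
  shows "upath F u v [u..<Suc v]"
proof -
  have "set (walk_edges [u..<Suc v]) \<subseteq> F"
    using assms(2) unfolding walk_edges_upt by auto
  then show ?thesis using assms(1) by (simp add: upath_def hd_append)
qed

lemma sp_dist_commute: "sp_dist c F u v = sp_dist c F v u"
proof -
  let ?L = "\<lambda>u v. {sum_list (map c (walk_edges xs)) |xs. upath F u v xs}"
  have "?L u v \<subseteq> ?L v u" for u v
  proof
    fix l assume "l \<in> ?L u v"
    then obtain xs where xs: "upath F u v xs" and l: "l = sum_list (map c (walk_edges xs))"
      by blast
    have "sum_list (map c (walk_edges (rev xs))) = l"
      unfolding l walk_edges_rev rev_map[symmetric] sum_list_rev ..
    with upath_rev[OF xs] show "l \<in> ?L v u"
      by blast
  qed
  then have "?L u v = ?L v u"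
    by blast
  then show ?thesis
    unfolding sp_dist_def by (rule arg_cong)
qed

lemma sp_dist_le: "upath F u v xs \<Longrightarrow> sp_dist c F u v \<le> sum_list (map c (walk_edges xs))"
  unfolding sp_dist_def by (intro cInf_lower) auto

lemma sp_dist_attained:
  assumes "upath F u v xs"
  obtains ys where "upath F u v ys" "sp_dist c F u v = sum_list (map c (walk_edges ys))"
proof -
  have "sp_dist c F u v \<in> {sum_list (map c (walk_edges xs)) |xs. upath F u v xs}"
    unfolding sp_dist_def using assms by (intro Inf_nat_def1) auto
  then show ?thesis using that by auto
qed

text \<open>Feasible potentials certify lower bounds on distances: the edge inequalities telescope
  along the walk. Since edges are unordered, the assumption bounds the change in both
  directions.\<close>

lemma potential_le_walk:
  fixes \<phi> :: "'v \<Rightarrow> nat"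
  assumes "\<And>x y. {x, y} \<in> F \<Longrightarrow> \<phi> y \<le> \<phi> x + c {x, y}"
  shows "xs \<noteq> [] \<Longrightarrow> set (walk_edges xs) \<subseteq> F \<Longrightarrow>
    \<phi> (last xs) \<le> \<phi> (hd xs) + sum_list (map c (walk_edges xs))"
proof (induction xs rule: list_nonempty_induct)
  case (cons x xs)
  then obtain y ys where "xs = y # ys" by (cases xs) auto
  then show ?case using cons assms[of x y] by auto
qed simp

section \<open>The instances\<close>

definition rim :: "nat \<Rightarrow> nat set" where
  "rim k = {k, Suc k}"

definition chord :: "nat \<Rightarrow> nat set" where
  "chord i = {3 * i, 3 * i + 2}"

definition closing :: "nat \<Rightarrow> nat set" where
  "closing n = {0, 3 * n - 1}"

definition ring_edges :: "nat \<Rightarrow> nat set set" where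
  "ring_edges n = rim ` {..<3 * n - 1} \<union> chord ` {..<n} \<union> {closing n}"

definition ring_cost :: "nat \<Rightarrow> nat set \<Rightarrow> int" where
  "ring_cost n e = (if e = closing n then 2 ^ n else if e \<in> range chord then 2 ^ (Min e div 3) else 0)"

text \<open>All edges starting in triple i have the same length, so the detour of two path edges
  costs one extra 2 ^ Suc i over the chord. The exponent \<open>Suc\<close> makes every edge but the
  closing one at least 2 long.\<close>

definition ring_length :: "nat \<Rightarrow> nat set \<Rightarrow> nat" where
  "ring_length n e = (if e = closing n then 1 else 2 ^ Suc (Min e div 3))"

definition ring :: "nat \<Rightarrow> nat msp" where
  "ring n = \<lparr>verts = {..<3 * n}, edges = ring_edges n, cost1 = ring_cost n, cost2 = ring_length n\<rparr>"

definition chord_free :: "nat \<Rightarrow> nat set \<Rightarrow> nat set set" where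
  "chord_free n X = rim ` {..<3 * n - 1} \<union> chord ` ({..<n} - X)"

lemma ring_simps [simp]:
  "verts (ring n) = {..<3 * n}" "edges (ring n) = ring_edges n"
  "cost1 (ring n) = ring_cost n" "cost2 (ring n) = ring_length n"
  by (simp_all add: ring_def)

lemma chord_inject [simp]: "chord i = chord j \<longleftrightarrow> i = j"
  by (auto simp: chord_def doubleton_eq_iff)

lemma rim_neq_chord [simp]: "rim k \<noteq> chord i" "chord i \<noteq> rim k"
  by (auto simp: rim_def chord_def doubleton_eq_iff)

lemma neq_closing [simp]:
  assumes "n \<ge> 2"
  shows "rim k \<noteq> closing n" "closing n \<noteq> rim k" "chord i \<noteq> closing n" "closing n \<noteq> chord i"
  using assms by (auto simp: rim_def chord_def closing_def doubleton_eq_iff)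

lemma ring_length_simps:
  assumes "n \<ge> 2"
  shows "ring_length n (rim k) = 2 ^ Suc (k div 3)"
    and "ring_length n (chord i) = 2 ^ Suc i"
    and "ring_length n (closing n) = 1"
proof -
  have "Min (rim k) = k" "Min (chord i) = 3 * i"
    by (auto simp: rim_def chord_def min_def)
  then show "ring_length n (rim k) = 2 ^ Suc (k div 3)" "ring_length n (chord i) = 2 ^ Suc i"
    "ring_length n (closing n) = 1"
    using assms by (simp_all add: ring_length_def)
qed

lemma ring_cost_simps:
  assumes "n \<ge> 2"
  shows "ring_cost n (rim k) = 0"
    and "ring_cost n (chord i) = 2 ^ i"
    and "ring_cost n (closing n) = 2 ^ n"
proof -
  have "Min (chord i) = 3 * i"
    by (auto simp: chord_def min_def)
  then show "ring_cost n (rim k) = 0" "ring_cost n (chord i) = 2 ^ i"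
    "ring_cost n (closing n) = 2 ^ n"
    using assms by (auto simp: ring_cost_def)
qed

lemma ring_length_pos: "ring_length n e > 0"
  by (simp add: ring_length_def)

lemma ring_cost_nonneg: "ring_cost n e \<ge> 0"
  by (simp add: ring_cost_def)

lemma finite_ring_edges [simp]: "finite (ring_edges n)"
  by (simp add: ring_edges_def)

lemma chord_free_subset: "chord_free n X \<subseteq> ring_edges n"
  by (auto simp: chord_free_def ring_edges_def)

section \<open>Connectivity and degrees of the instances\<close>

lemma rim_upath:
  assumes "u \<le> v" "v < 3 * n" "rim ` {..<3 * n - 1} \<subseteq> F"
  shows "upath F u v [u..<Suc v]"
  using assms by (intro upath_upt) (auto simp: rim_def subset_eq)

lemma rim_connected:
  assumes "n \<ge> 1" "rim ` {..<3 * n - 1} \<subseteq> F"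
  shows "graph_connected {..<3 * n} F"
  unfolding graph_connected_def
proof (intro conjI ballI)
  fix u v :: nat assume "u \<in> {..<3 * n}" "v \<in> {..<3 * n}"
  then show "\<exists>xs. upath F u v xs"
    using rim_upath[OF _ _ assms(2)] upath_rev by (meson lessThan_iff nat_le_linear)
qed (use assms in \<open>auto simp: lessThan_empty_iff\<close>)

lemma msp_instance_ring:
  assumes "n \<ge> 2"
  shows "msp_instance (ring n)"
proof -
  have "e \<subseteq> {..<3 * n} \<and> card e = 2" if "e \<in> ring_edges n" for e
    using that assms by (auto simp: ring_edges_def rim_def chord_def closing_def card_insert_if)
  moreover have "graph_connected {..<3 * n} (ring_edges n)"
    using assms by (intro rim_connected) (auto simp: ring_edges_def)
  ultimately show ?thesis
    using assms by (auto simp: msp_instance_def simple_graph_def ring_length_pos)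
qed

lemma spanner_chord_free:
  assumes "n \<ge> 2"
  shows "spanner (ring n) (chord_free n X)"
proof -
  have "graph_connected {..<3 * n} (chord_free n X)"
    using assms by (intro rim_connected) (auto simp: chord_free_def)
  then show ?thesis
    by (simp add: spanner_def chord_free_subset)
qed

text \<open>The chords live on disjoint triples of vertices, so \<open>v\<close> can only meet the
  chord of its own triple, besides its two neighbours on the cycle formed by the path and the
  closing edge.\<close>

lemma degree_bounded_ring:
  assumes "n \<ge> 2"
  shows "degree_bounded 3 {..<3 * n} (ring_edges n)"
  unfolding degree_bounded_def
proof
  fix v assume v: "v \<in> {..<3 * n}"
  let ?A = "{if v = 0 then closing n else rim (v - 1),
             if v = 3 * n - 1 then closing n else rim v, chord (v div 3)}"
  have "rim k \<in> ?A" if k: "v \<in> rim k" "k < 3 * n - 1" for k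
  proof -
    consider "v = k" | "v = Suc k" using k(1) by (auto simp: rim_def)
    then show ?thesis using k(2) by cases simp_all
  qed
  moreover have "chord i \<in> ?A" if "v \<in> chord i" for i
  proof -
    have "v div 3 = i" using that by (auto simp: chord_def)
    then show ?thesis by simp
  qed
  moreover have "closing n \<in> ?A" if "v \<in> closing n"
  proof -
    have "v = 0 \<or> v = 3 * n - 1" using that by (simp add: closing_def)
    then show ?thesis by fastforce
  qed
  ultimately have "{e \<in> ring_edges n. v \<in> e} \<subseteq> ?A"
    unfolding ring_edges_def by blast
  then have "card {e \<in> ring_edges n. v \<in> e} \<le> card ?A"
    by (intro card_mono) auto
  also have "card {a, b, c} \<le> 3" for a b c :: "nat set"
    by (simp add: card_insert_if)
  finally show "card {e \<in> ring_edges n. v \<in> e} \<le> 3" .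
qed

section \<open>Values of spanners\<close>

text \<open>The distance from \<open>0\<close> to \<open>v\<close>, shifted by \<open>4\<close>, if the closing edge and the chords in \<open>X\<close>
  are missing; the shift avoids subtraction.\<close>

definition height :: "nat set \<Rightarrow> nat \<Rightarrow> nat" where
  "height X v = (let i = v div 3 in
     if v mod 3 = 0 then 4 * 2 ^ i + 2 * set_encode (X \<inter> {..<i})
     else if v mod 3 = 1 then 6 * 2 ^ i + 2 * set_encode (X \<inter> {..<i})
     else 6 * 2 ^ i + 2 * set_encode (X \<inter> {..<Suc i}))"

lemma set_encode_Int_Suc:
  "set_encode (X \<inter> {..<Suc i}) = set_encode (X \<inter> {..<i}) + (if i \<in> X then 2 ^ i else 0)"
proof -
  have "X \<inter> {..<Suc i} = (if i \<in> X then insert i (X \<inter> {..<i}) else X \<inter> {..<i})"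
    by (auto simp: less_Suc_eq)
  then show ?thesis
    by (simp add: set_encode_insert)
qed

lemma div_3_simps: "Suc (3 * i) div 3 = i" "Suc (Suc (3 * i)) div 3 = i"
  by presburger+

lemma height_simps:
  "height X 0 = 4"
  "height X (3 * i) = 4 * 2 ^ i + 2 * set_encode (X \<inter> {..<i})"
  "height X (Suc (3 * i)) = 6 * 2 ^ i + 2 * set_encode (X \<inter> {..<i})"
  "height X (Suc (Suc (3 * i))) = 6 * 2 ^ i + 2 * set_encode (X \<inter> {..<Suc i})"
  "height X (Suc (Suc (Suc (3 * i)))) = 8 * 2 ^ i + 2 * set_encode (X \<inter> {..<Suc i})"
proof -
  have [simp]: "Suc (3 * i) mod 3 = 1" "Suc (Suc (3 * i)) mod 3 = 2"
    "Suc (Suc (Suc (3 * i))) mod 3 = 0" "Suc (Suc (Suc (3 * i))) div 3 = Suc i"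
    by presburger+
  show "height X 0 = 4"
    "height X (3 * i) = 4 * 2 ^ i + 2 * set_encode (X \<inter> {..<i})"
    "height X (Suc (3 * i)) = 6 * 2 ^ i + 2 * set_encode (X \<inter> {..<i})"
    "height X (Suc (Suc (3 * i))) = 6 * 2 ^ i + 2 * set_encode (X \<inter> {..<Suc i})"
    "height X (Suc (Suc (Suc (3 * i)))) = 8 * 2 ^ i + 2 * set_encode (X \<inter> {..<Suc i})"
    by (simp_all add: height_def div_3_simps)
qed

lemma height_end:
  assumes "n \<ge> 1"
  shows "height X (3 * n - 1) = 3 * 2 ^ n + 2 * set_encode (X \<inter> {..<n})"
proof -
  obtain m where "n = Suc m" using assms by (cases n) auto
  then show ?thesis using height_simps(4)[of X m] by simp
qed

lemma residue_cases:
  fixes k :: nat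
  obtains i where "k = 3 * i" | i where "k = Suc (3 * i)" | i where "k = Suc (Suc (3 * i))"
proof -
  have "k = 3 * (k div 3) \<or> k = Suc (3 * (k div 3)) \<or> k = Suc (Suc (3 * (k div 3)))"
    by presburger
  then show thesis using that by blast
qed

text \<open>Along path edges \<open>height X\<close> is a feasible potential. On the edge from 3i +
  1 to 3i + 2 it stays constant if chord i is present, since both ends are then equally far from
  3i.\<close>

lemma height_Suc:
  "height X k \<le> height X (Suc k) \<and> height X (Suc k) \<le> height X k + 2 ^ Suc (k div 3)"
  by (cases k rule: residue_cases) (simp_all add: div_3_simps height_simps set_encode_Int_Suc)

lemma height_mono: "u \<le> v \<Longrightarrow> height X u \<le> height X v"
  by (rule lift_Suc_mono_le[of "height X"]) (simp_all add: height_Suc)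

text \<open>Without any chord the path is the only route, so each path edge is tight; differences of
  \<open>height UNIV\<close> are lengths of subpaths.\<close>

lemma height_UNIV_Suc: "height UNIV (Suc k) = height UNIV k + 2 ^ Suc (k div 3)"
  by (cases k rule: residue_cases)
     (use set_encode_Int_Suc[of UNIV] in \<open>simp_all add: div_3_simps height_simps\<close>)

lemma height_chord:
  assumes "i \<notin> X"
  shows "height X (Suc (Suc (3 * i))) = height X (3 * i) + 2 ^ Suc i"
  using assms by (simp add: height_simps set_encode_Int_Suc)

text \<open>The height for the missing chords is a feasible potential on whatever edges
  \<open>S\<close> has. Missing path edges only remove constraints, so the bound covers all spanners
  without the closing edge. The 4 is the height of vertex 0.\<close>

lemma closing_distance_ge:
  assumes "n \<ge> 2" "spanner (ring n) S" "closing n \<notin> S"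
  shows "height {i. i < n \<and> chord i \<notin> S} (3 * n - 1) \<le> sp_dist (ring_length n) S 0 (3 * n - 1) + 4"
proof -
  let ?X = "{i. i < n \<and> chord i \<notin> S}"
  have S: "S \<subseteq> ring_edges n" "graph_connected {..<3 * n} S"
    using assms(2) by (auto simp: spanner_def)
  have "height ?X y \<le> height ?X x + ring_length n {x, y}" if xy: "{x, y} \<in> S" for x y
  proof -
    from xy S(1) assms(3) consider k where "{x, y} = rim k" | i where "{x, y} = chord i" "i < n"
      unfolding ring_edges_def by auto
    then show ?thesis
    proof cases
      case 1
      then have "x = k \<and> y = Suc k \<or> x = Suc k \<and> y = k"
        by (auto simp: rim_def doubleton_eq_iff)
      then show ?thesis
        using height_Suc[of ?X k] unfolding 1 ring_length_simps(1)[OF assms(1)] by auto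
    next
      case 2
      then have "i \<notin> ?X" using xy by auto
      moreover have "x = 3 * i \<and> y = Suc (Suc (3 * i)) \<or> x = Suc (Suc (3 * i)) \<and> y = 3 * i"
        using 2 by (auto simp: chord_def doubleton_eq_iff)
      ultimately show ?thesis
        using height_chord[of i ?X] unfolding 2 ring_length_simps(2)[OF assms(1)] by auto
    qed
  qed
  note potential = potential_le_walk[of S "height ?X", OF this]
  obtain xs where "upath S 0 (3 * n - 1) xs"
    using S(2) assms(1) unfolding graph_connected_def by fastforce
  then obtain ys where "upath S 0 (3 * n - 1) ys"
    and "sp_dist (ring_length n) S 0 (3 * n - 1) = sum_list (map (ring_length n) (walk_edges ys))"
    by (rule sp_dist_attained)
  then show ?thesis
    using potential[of ys] by (simp add: upath_def height_simps)
qed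

text \<open>The path that takes each present chord and detours around each missing one attains the
  potential bound. The bound on the vertices of \<open>xs\<close> is there for the induction: it
  makes the next gadget disjoint from the path built so far.\<close>

lemma chord_free_path:
  assumes "n \<ge> 2" "i < n"
  shows "\<exists>xs. upath (chord_free n X) 0 (Suc (Suc (3 * i))) xs \<and> set xs \<subseteq> {..Suc (Suc (3 * i))} \<and>
    sum_list (map (ring_length n) (walk_edges xs)) + 4 = height X (Suc (Suc (3 * i)))"
proof -
  define gadget where "gadget i = (if i \<in> X then [3 * i, Suc (3 * i), Suc (Suc (3 * i))]
    else [3 * i, Suc (Suc (3 * i))])" for i
  have gadget: "gadget i \<noteq> []" "hd (gadget i) = 3 * i" "last (gadget i) = Suc (Suc (3 * i))"
    "distinct (gadget i)" "set (gadget i) \<subseteq> {3 * i..Suc (Suc (3 * i))}" for i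
    by (auto simp: gadget_def)
  have rim: "rim k \<in> chord_free n X" if "k < 3 * n - 1" for k
    using that by (simp add: chord_free_def)
  have walk_gadget: "walk_edges (gadget i) =
    (if i \<in> X then [rim (3 * i), rim (Suc (3 * i))] else [chord i])" for i
    by (simp add: gadget_def rim_def chord_def)
  have edges: "set (walk_edges (gadget i)) \<subseteq> chord_free n X" if "i < n" for i
    unfolding walk_gadget using that by (auto intro!: rim simp: chord_free_def)
  have length: "height X (3 * i) + sum_list (map (ring_length n) (walk_edges (gadget i))) =
    height X (Suc (Suc (3 * i)))" for i
    by (simp add: walk_gadget div_3_simps ring_length_simps assms(1) height_simps set_encode_Int_Suc)
  show ?thesis
    using assms(2)
  proof (induction i)
    case 0
    have "upath (chord_free n X) 0 (Suc (Suc (3 * 0))) (gadget 0)"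
      using gadget[of 0] edges[of 0] assms by (simp add: upath_def)
    moreover have "sum_list (map (ring_length n) (walk_edges (gadget 0))) + 4 = height X (Suc (Suc (3 * 0)))"
      using length[of 0] by (simp add: height_simps(1))
    ultimately show ?case
      using gadget(5)[of 0] by (intro exI[of _ "gadget 0"]) auto
  next
    case (Suc i)
    then obtain xs where xs: "upath (chord_free n X) 0 (Suc (Suc (3 * i))) xs"
      "set xs \<subseteq> {..Suc (Suc (3 * i))}"
      "sum_list (map (ring_length n) (walk_edges xs)) + 4 = height X (Suc (Suc (3 * i)))"
      by auto
    then have ne: "xs \<noteq> []" "last xs = Suc (Suc (3 * i))" by (auto simp: upath_def)
    let ?ys = "xs @ gadget (Suc i)" and ?k = "Suc (Suc (3 * i))"
    have rim_k: "{?k, 3 * Suc i} = rim ?k"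
      unfolding rim_def by (rule arg_cong) simp
    have walk: "walk_edges ?ys = walk_edges xs @ rim ?k # walk_edges (gadget (Suc i))"
      unfolding walk_edges_append[OF ne(1) gadget(1)] gadget(2) ne(2) rim_k ..
    have "set xs \<inter> set (gadget (Suc i)) = {}"
      using xs(2) gadget(5)[of "Suc i"] by fastforce
    then have "upath (chord_free n X) 0 (Suc (Suc (3 * Suc i))) ?ys"
      using xs(1) gadget[of "Suc i"] edges[of "Suc i"] rim[of ?k] Suc.prems
      unfolding upath_def walk by auto
    moreover have "set ?ys \<subseteq> {..Suc (Suc (3 * Suc i))}"
      using xs(2) gadget(5)[of "Suc i"] by fastforce
    moreover have "sum_list (map (ring_length n) (walk_edges ?ys)) + 4 = height X (Suc (Suc (3 * Suc i)))"
    proof -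
      have "height X ?k + ring_length n (rim ?k) = height X (3 * Suc i)"
        using height_simps(4)[of X i] height_simps(2)[of X "Suc i"] by (simp add: div_3_simps ring_length_simps assms(1))
      then show ?thesis
        using xs(3) length[of "Suc i"] unfolding walk by simp
    qed
    ultimately show ?case by blast
  qed
qed

lemma closing_distance_chord_free_le:
  assumes "n \<ge> 2"
  shows "sp_dist (ring_length n) (chord_free n X) 0 (3 * n - 1) + 4 \<le> height X (3 * n - 1)"
proof -
  have eq: "Suc (Suc (3 * (n - 1))) = 3 * n - 1"
    using assms by simp
  obtain xs where "upath (chord_free n X) 0 (3 * n - 1) xs"
    "sum_list (map (ring_length n) (walk_edges xs)) + 4 = height X (3 * n - 1)"
    using chord_free_path[of n "n - 1" X, unfolded eq] assms by auto
  then show ?thesis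
    using sp_dist_le[of "chord_free n X" 0 "3 * n - 1" xs "ring_length n"] by simp
qed

text \<open>A crude bound that ignores all chords and follows the path from \<open>u\<close> to
  \<open>v\<close>. It suffices for pairs whose distance is divided by at least 2.\<close>

lemma distance_chord_free_le:
  assumes "n \<ge> 2" "u < 3 * n" "v < 3 * n"
  shows "sp_dist (ring_length n) (chord_free n X) u v + 4 \<le> height UNIV (3 * n - 1)"
proof -
  have le: "sp_dist (ring_length n) (chord_free n X) u v + 4 \<le> height UNIV (3 * n - 1)"
    if uv: "u \<le> v" "v < 3 * n" for u v
  proof -
    have "sum_list (map (ring_length n) (walk_edges [u..<Suc v])) + height UNIV u = height UNIV v"
      using uv(1)
    proof (induction v rule: dec_induct)
      case (step m)
      then show ?case
        using ring_length_simps(1)[OF assms(1), of m, unfolded rim_def]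
        by (simp add: walk_edges_upt height_UNIV_Suc del: upt_Suc) (simp add: height_UNIV_Suc)
    qed simp
    moreover have "height UNIV u \<ge> 4"
      using height_mono[of 0 u UNIV] by (simp add: height_simps)
    moreover have "height UNIV v \<le> height UNIV (3 * n - 1)"
      using uv by (simp add: height_mono)
    moreover have "upath (chord_free n X) u v [u..<Suc v]"
      using uv by (intro rim_upath[of u v n]) (auto simp: chord_free_def)
    ultimately show ?thesis
      using sp_dist_le[of "chord_free n X" u v "[u..<Suc v]" "ring_length n"] by linarith
  qed
  show ?thesis
    using le[of u v] le[of v u] assms by (cases "u \<le> v") (simp_all add: sp_dist_commute[of _ _ u v])
qed

text \<open>A path of one edge other than the closing edge has length at least 2 by the choice of
  lengths, and a path of two or more edges has it because all lengths are positive.\<close>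

lemma ring_distance_ge:
  assumes "n \<ge> 2" "u \<in> verts (ring n)" "v \<in> verts (ring n)" "u \<noteq> v"
  shows "sp_dist (ring_length n) (ring_edges n) u v \<ge> (if {u, v} = closing n then 1 else 2)"
proof -
  have "graph_connected {..<3 * n} (ring_edges n)"
    using msp_instance_ring[OF assms(1)] by (simp add: msp_instance_def)
  then obtain xs where "upath (ring_edges n) u v xs"
    using assms unfolding graph_connected_def by auto
  then obtain ys where ys: "upath (ring_edges n) u v ys"
    and eq: "sp_dist (ring_length n) (ring_edges n) u v = sum_list (map (ring_length n) (walk_edges ys))"
    by (rule sp_dist_attained)
  then obtain x zs where zs: "ys = u # x # zs"
    using assms(4) unfolding upath_def by (metis last.simps list.exhaust_sel)
  have pos: "ring_length n e \<ge> 1" for e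
    using ring_length_pos[of n e] by simp
  show ?thesis
  proof (cases zs)
    case Nil
    then show ?thesis
      using ys zs eq by (auto simp: upath_def ring_length_def)
  next
    case (Cons z zs')
    then show ?thesis
      using eq zs pos[of "{u, x}"] pos[of "{x, z}"] by auto
  qed
qed

section \<open>Bounds on the stretch and cost of spanners\<close>

lemma f2_set_finite:
  "finite (verts I) \<Longrightarrow> finite {of_nat (sp_dist (cost2 I) S u v) / of_nat (sp_dist (cost2 I) (edges I) u v)
     | u v. u \<in> verts I \<and> v \<in> verts I \<and> u \<noteq> v}"
  (is "_ \<Longrightarrow> finite {?f u v | u v. _ u v}")
  by (rule finite_subset[of _ "(\<lambda>(u, v). ?f u v) ` (verts I \<times> verts I)"]) auto

lemma f2_ge:
  assumes "finite (verts I)" "u \<in> verts I" "v \<in> verts I" "u \<noteq> v"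
  shows "of_nat (sp_dist (cost2 I) S u v) / of_nat (sp_dist (cost2 I) (edges I) u v) \<le> f2 I S"
  unfolding f2_def using assms by (intro Max_ge f2_set_finite) auto

lemma f2_le:
  assumes "finite (verts I)" "card (verts I) \<ge> 2"
    and "\<And>u v. u \<in> verts I \<Longrightarrow> v \<in> verts I \<Longrightarrow> u \<noteq> v \<Longrightarrow>
      of_nat (sp_dist (cost2 I) S u v) / of_nat (sp_dist (cost2 I) (edges I) u v) \<le> b"
  shows "f2 I S \<le> b"
proof -
  have "\<exists>u v. u \<in> verts I \<and> v \<in> verts I \<and> u \<noteq> v"
    using assms(1,2) card_le_Suc0_iff_eq[of "verts I"] by auto
  then show ?thesis
    unfolding f2_def using assms by (intro Max.boundedI f2_set_finite) auto
qed

lemma set_encode_lessThan: "set_encode {..<n} + 1 = 2 ^ n"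
proof (induction n)
  case (Suc n)
  then show ?case
    using set_encode_Int_Suc[of UNIV n] by simp
qed (simp add: set_encode_def)

lemma set_encode_complement:
  assumes "X \<subseteq> {..<n}"
  shows "set_encode ({..<n} - X) + set_encode X + 1 = 2 ^ n"
proof -
  have "set_encode ({..<n} - X) + set_encode X = set_encode {..<n}"
    unfolding set_encode_def using assms by (intro sum.subset_diff[symmetric]) auto
  then show ?thesis
    using set_encode_lessThan[of n] by simp
qed

lemma closing_distance:
  assumes "n \<ge> 2"
  shows "sp_dist (ring_length n) (ring_edges n) 0 (3 * n - 1) = 1"
proof (rule antisym)
  have "upath (ring_edges n) 0 (3 * n - 1) [0, 3 * n - 1]"
    using assms by (simp add: upath_def ring_edges_def closing_def)
  from sp_dist_le[OF this, of "ring_length n"]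
  show "sp_dist (ring_length n) (ring_edges n) 0 (3 * n - 1) \<le> 1"
    using ring_length_simps(3)[OF assms] by (simp add: closing_def)
  show "sp_dist (ring_length n) (ring_edges n) 0 (3 * n - 1) \<ge> 1"
    using ring_distance_ge[OF assms, of 0 "3 * n - 1"] assms by (simp add: closing_def)
qed

text \<open>It suffices to look at the pair (0, 3n - 1): its distance in the full graph is 1, so its
  ratio is its distance in \<open>S\<close>.\<close>

lemma f2_ring_ge:
  assumes "n \<ge> 2" "spanner (ring n) S" "closing n \<notin> S"
  shows "3 * 2 ^ n + 2 * of_nat (set_encode {i. i < n \<and> chord i \<notin> S}) \<le> f2 (ring n) S + 4"
proof -
  let ?X = "{i. i < n \<and> chord i \<notin> S}" and ?d = "sp_dist (ring_length n) S 0 (3 * n - 1)"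
  have "?X \<inter> {..<n} = ?X" by auto
  then have "3 * 2 ^ n + 2 * set_encode ?X \<le> ?d + 4"
    using closing_distance_ge[OF assms] height_end[of n ?X] assms(1) by simp
  then have "(of_nat (3 * 2 ^ n + 2 * set_encode ?X) :: rat) \<le> of_nat (?d + 4)"
    by (rule of_nat_mono)
  moreover have "of_nat ?d \<le> f2 (ring n) S"
    using f2_ge[of "ring n" 0 "3 * n - 1" S] closing_distance[OF assms(1)] assms(1) by simp
  ultimately show ?thesis by simp
qed

text \<open>A detour between endpoints of the closing edge is measured against length \<open>1\<close>, every other
  one against length at least \<open>2\<close>; hence the closing edge determines the stretch.\<close>

lemma f2_chord_free_le:
  assumes "n \<ge> 2" "X \<subseteq> {..<n}"
  shows "f2 (ring n) (chord_free n X) + 4 \<le> 3 * 2 ^ n + 2 * of_nat (set_encode X)"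
proof -
  let ?b = "3 * 2 ^ n + 2 * of_nat (set_encode X) - 4 :: rat"
  let ?d = "sp_dist (ring_length n) (chord_free n X)"
  have X: "X \<inter> {..<n} = X" using assms(2) by auto
  have "?d 0 (3 * n - 1) + 4 \<le> 3 * 2 ^ n + 2 * set_encode X"
    using closing_distance_chord_free_le[OF assms(1), of X] height_end[of n X] assms(1) X by simp
  then have "of_nat (?d 0 (3 * n - 1) + 4) \<le> (of_nat (3 * 2 ^ n + 2 * set_encode X) :: rat)"
    by (rule of_nat_mono)
  then have closing: "of_nat (?d 0 (3 * n - 1)) \<le> ?b"
    by simp
  have other: "of_nat (?d u v) \<le> 2 * ?b" if "u < 3 * n" "v < 3 * n" for u v
  proof -
    \<comment> \<open>By \<open>height_end\<close> and \<open>set_encode_lessThan\<close>,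
      \<open>height UNIV (3 * n - 1)\<close> is 3 * 2^n + 2 * (2^n - 1) = 5 * 2^n - 2. Then 5 * 2^n
      - 6 <= 2 * (3 * 2^n - 4) amounts to 2 <= 2^n.\<close>
    have "?d u v + 6 \<le> 5 * 2 ^ n"
      using distance_chord_free_le[OF assms(1) that, of X] height_end[of n UNIV] assms(1)
        set_encode_lessThan[of n] by simp
    moreover have "(2::nat) ^ 1 \<le> 2 ^ n"
      using assms(1) by (intro power_increasing) auto
    ultimately have "?d u v + 8 \<le> 6 * 2 ^ n + 4 * set_encode X"
      by simp
    then have "of_nat (?d u v + 8) \<le> (of_nat (6 * 2 ^ n + 4 * set_encode X) :: rat)"
      by (rule of_nat_mono)
    then show ?thesis by simp
  qed
  have "f2 (ring n) (chord_free n X) \<le> ?b"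
  proof (rule f2_le)
    fix u v assume uv: "u \<in> verts (ring n)" "v \<in> verts (ring n)" "u \<noteq> v"
    let ?e = "sp_dist (ring_length n) (ring_edges n)"
    have "of_nat (?d u v) / of_nat (?e u v) \<le> ?b"
    proof (cases "{u, v} = closing n")
      case True
      then have "u = 0 \<and> v = 3 * n - 1 \<or> u = 3 * n - 1 \<and> v = 0"
        by (auto simp: closing_def doubleton_eq_iff)
      then have "?d u v = ?d 0 (3 * n - 1)" "?e u v = 1"
        using closing_distance[OF assms(1)] sp_dist_commute by metis+
      then show ?thesis using closing by simp
    next
      case False
      then have e: "?e u v \<ge> 2"
        using ring_distance_ge[OF assms(1) uv] by simp
      have "of_nat (?d u v) \<le> 2 * ?b"
        using other uv by simp
      also have "\<dots> \<le> of_nat (?e u v) * ?b"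
      proof (rule mult_right_mono)
        show "(2 :: rat) \<le> of_nat (?e u v)"
          using of_nat_mono[OF e] by simp
        have "(0::rat) \<le> of_nat (?d 0 (3 * n - 1))" by simp
        then show "0 \<le> ?b" using closing by linarith
      qed
      finally show ?thesis
        using e by (subst divide_le_eq) (simp add: mult.commute)
    qed
    then show "of_nat (sp_dist (cost2 (ring n)) (chord_free n X) u v) /
        of_nat (sp_dist (cost2 (ring n)) (edges (ring n)) u v) \<le> ?b"
      by simp
  qed (use assms in auto)
  then show ?thesis by simp
qed

lemma f1_ring_ge:
  assumes "n \<ge> 2" "S \<subseteq> ring_edges n" "closing n \<in> S"
  shows "f1 (ring n) S \<ge> 2 ^ n"
proof -
  have "finite S" using assms(2) finite_ring_edges by (rule finite_subset)
  then have "ring_cost n (closing n) \<le> (\<Sum>e\<in>S. ring_cost n e)"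
    using assms(3) by (intro member_le_sum) (auto simp: ring_cost_nonneg)
  then show ?thesis
    using assms(1) by (simp add: f1_def ring_cost_simps)
qed

lemma f1_ring_eq:
  assumes "n \<ge> 2" "S \<subseteq> ring_edges n" "closing n \<notin> S"
  shows "f1 (ring n) S = int (set_encode {i. i < n \<and> chord i \<in> S})"
proof -
  let ?Y = "{i. i < n \<and> chord i \<in> S}"
  have "(\<Sum>e\<in>S. ring_cost n e) = (\<Sum>e\<in>chord ` ?Y. ring_cost n e)"
  proof (rule sum.mono_neutral_right)
    show "finite S" using assms(2) finite_ring_edges by (rule finite_subset)
    show "\<forall>e\<in>S - chord ` ?Y. ring_cost n e = 0"
    proof
      fix e assume "e \<in> S - chord ` ?Y"
      then obtain k where "e = rim k"
        using assms(2,3) unfolding ring_edges_def by blast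
      then show "ring_cost n e = 0" using ring_cost_simps assms(1) by simp
    qed
  qed auto
  also have "\<dots> = (\<Sum>i\<in>?Y. 2 ^ i)"
    by (subst sum.reindex) (simp_all add: inj_on_def ring_cost_simps assms(1))
  finally show ?thesis
    by (simp add: f1_def set_encode_def)
qed

lemma chord_free_chords:
  assumes "n \<ge> 2" "X \<subseteq> {..<n}"
  shows "closing n \<notin> chord_free n X" "{i. i < n \<and> chord i \<in> chord_free n X} = {..<n} - X"
  using assms by (auto simp: chord_free_def)

lemma f1_chord_free:
  assumes "n \<ge> 2" "X \<subseteq> {..<n}"
  shows "f1 (ring n) (chord_free n X) = int (set_encode ({..<n} - X))"
  using f1_ring_eq[OF assms(1) chord_free_subset chord_free_chords(1)[OF assms]]
    chord_free_chords(2)[OF assms] by simp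

text \<open>A dominating \<open>S'\<close> is too cheap to contain the closing edge. Its cost being
  no larger forces its omitted chords to weigh at least w(X), and its stretch being no larger forces
  at most w(X). So both coordinates agree, contradicting domination.\<close>

lemma chord_free_nondominated:
  assumes "n \<ge> 2" "X \<subseteq> {..<n}"
  shows "value_vector (ring n) (chord_free n X) \<in> nondominated_set (ring n)"
proof -
  let ?S = "chord_free n X"
  have False if S': "spanner (ring n) S'"
    and dom: "dominated_by (value_vector (ring n) ?S) (value_vector (ring n) S')" for S'
  proof -
    let ?Y = "{i. i < n \<and> chord i \<in> S'}" and ?X' = "{i. i < n \<and> chord i \<notin> S'}"
    have le: "f1 (ring n) S' \<le> f1 (ring n) ?S" "f2 (ring n) S' \<le> f2 (ring n) ?S"
      and neq: "f1 (ring n) S' \<noteq> f1 (ring n) ?S \<or> f2 (ring n) S' \<noteq> f2 (ring n) ?S"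
      using dom by (auto simp: dominated_by_def value_vector_def)
    have sub: "S' \<subseteq> ring_edges n" using S' by (simp add: spanner_def)
    have f1: "f1 (ring n) ?S = int (set_encode ({..<n} - X))"
      using f1_chord_free[OF assms] .
    have compl: "set_encode ({..<n} - X) + set_encode X + 1 = 2 ^ n"
      using set_encode_complement[OF assms(2)] .
    then have "f1 (ring n) ?S < 2 ^ n"
      unfolding f1 by (metis Suc_eq_plus1 add_Suc_right le_add1 le_imp_less_Suc of_nat_less_iff
          of_nat_numeral of_nat_power)
    then have cl: "closing n \<notin> S'"
      using f1_ring_ge[OF assms(1) sub] le(1) by auto
    have "{..<n} - ?X' = ?Y" by auto
    then have compl': "set_encode ?Y + set_encode ?X' + 1 = 2 ^ n"
      using set_encode_complement[of ?X' n] by auto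
    have f1': "f1 (ring n) S' = int (set_encode ?Y)"
      using f1_ring_eq[OF assms(1) sub cl] .
    have "set_encode X \<le> set_encode ?X'"
      using le(1) compl compl' unfolding f1 f1' by linarith
    then have "(of_nat (set_encode X) :: rat) \<le> of_nat (set_encode ?X')"
      by (rule of_nat_mono)
    moreover note f2_ring_ge[OF assms(1) S' cl] f2_chord_free_le[OF assms] le(2)
    ultimately have "f2 (ring n) S' = f2 (ring n) ?S"
      and "(of_nat (set_encode X) :: rat) = of_nat (set_encode ?X')"
      by linarith+
    then have "set_encode X = set_encode ?X'" "f2 (ring n) S' = f2 (ring n) ?S"
      by simp_all
    then show False
      using neq compl compl' unfolding f1 f1' by linarith
  qed
  then show ?thesis
    unfolding nondominated_set_def using spanner_chord_free[OF assms(1)] by blast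
qed

text \<open>Stated for a finite superset \<open>A\<close> because \<open>card\<close> of an infinite
  set is 0; finiteness will come from the output list. The first coordinates alone separate the
  values, as binary representations are unique.\<close>

lemma nondominated_ring_many:
  assumes "n \<ge> 2" "finite A" "nondominated_set (ring n) \<subseteq> A"
  shows "2 ^ n \<le> card A"
proof -
  let ?f = "\<lambda>X. value_vector (ring n) (chord_free n X)"
  have "inj_on ?f (Pow {..<n})"
  proof (rule inj_onI)
    fix X Y assume XY: "X \<in> Pow {..<n}" "Y \<in> Pow {..<n}" "?f X = ?f Y"
    then have "set_encode ({..<n} - X) = set_encode ({..<n} - Y)"
      using f1_chord_free[OF assms(1)] by (simp add: value_vector_def)
    then have "{..<n} - X = {..<n} - Y"
      by (simp add: set_encode_eq)
    then show "X = Y" using XY by blast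
  qed
  then have "card (Pow {..<n}) = card (?f ` Pow {..<n})"
    by (simp add: card_image)
  also have "\<dots> \<le> card A"
    using chord_free_nondominated[OF assms(1)] assms(2,3) by (intro card_mono) auto
  finally show ?thesis
    by (simp add: card_Pow)
qed

section \<open>Outerplanarity\<close>

definition parabola :: "nat \<Rightarrow> complex" where
  "parabola k = Complex (real k) ((real k)\<^sup>2)"

lemma parabola_simps [simp]: "Re (parabola k) = real k" "Im (parabola k) = (real k)\<^sup>2"
  by (simp_all add: parabola_def)

lemma parabola_inject [simp]: "parabola a = parabola b \<longleftrightarrow> a = b"
  by (auto simp: parabola_def)

text \<open>The last equation measures how far the segment is above the parabola; this excess
  vanishes only at the two endpoints.\<close>

lemma parabola_segment:
  assumes "z \<in> closed_segment (parabola a) (parabola b)" "a \<le> b"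
  shows "real a \<le> Re z" "Re z \<le> real b" "Im z - (Re z)\<^sup>2 = (Re z - real a) * (real b - Re z)"
proof -
  obtain t where t: "0 \<le> t" "t \<le> 1" and z: "z = (1 - t) *\<^sub>R parabola a + t *\<^sub>R parabola b"
    using assms(1) by (auto simp: in_segment)
  have re: "Re z = real a + t * (real b - real a)"
    unfolding z by (simp add: algebra_simps)
  show "real a \<le> Re z"
    unfolding re using t assms(2) by simp
  have "t * (real b - real a) \<le> 1 * (real b - real a)"
    using t assms(2) by (intro mult_right_mono) auto
  then show "Re z \<le> real b"
    unfolding re by simp
  show "Im z - (Re z)\<^sup>2 = (Re z - real a) * (real b - Re z)"
    unfolding z by (simp add: power2_eq_square algebra_simps)
qed

text \<open>Strictly between \<open>c\<close> and \<open>d\<close> the outer segment has strictly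
  larger excess over the parabola than the inner one. So a common point has excess 0 on both and is
  an endpoint of both.\<close>

lemma parabola_segments_nested:
  assumes "z \<in> closed_segment (parabola a) (parabola b)" "z \<in> closed_segment (parabola c) (parabola d)"
    and "a \<le> c" "c < d" "d \<le> b" "(a, b) \<noteq> (c, d)"
  shows "\<exists>k \<in> {a, b} \<inter> {c, d}. z = parabola k"
proof -
  define x where "x = Re z"
  have ab: "Im z - x\<^sup>2 = (x - a) * (b - x)" and cd: "Im z - x\<^sup>2 = (x - c) * (d - x)"
    and x: "real c \<le> x" "x \<le> real d"
    using parabola_segment[OF assms(1)] parabola_segment[OF assms(2)] assms(3-) by (auto simp: x_def)
  have eq: "(x - a) * (b - x) = (x - c) * (d - x)" using ab cd by simp
  have "(x - c) * (d - x) = 0"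
  proof (rule ccontr)
    assume "(x - c) * (d - x) \<noteq> 0"
    then have pos: "x - c > 0" "d - x > 0" using x by auto
    have "real a < real c \<or> real d < real b" using assms(3,5,6) by auto
    then have "(x - c) * (d - x) < (x - a) * (b - x)"
      using pos assms(3,5) by (auto intro: mult_le_less_imp_less mult_less_le_imp_less)
    then show False using eq by simp
  qed
  then have xcd: "x = c \<or> x = d" "Im z = x\<^sup>2" and xab: "x = a \<or> x = b"
    using cd eq by auto
  have "z = parabola k" if "x = real k" for k
    using that xcd(2) by (simp add: complex_eq_iff x_def)
  then show ?thesis
    using xcd(1) xab by auto
qed

text \<open>The ranges of real parts share at most the point b = c.\<close>

lemma parabola_segments_consecutive:
  assumes "z \<in> closed_segment (parabola a) (parabola b)" "z \<in> closed_segment (parabola c) (parabola d)"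
    and "a < b" "b \<le> c" "c < d"
  shows "\<exists>k \<in> {a, b} \<inter> {c, d}. z = parabola k"
proof -
  have "Re z = real b" "b = c"
    using parabola_segment[OF assms(1)] parabola_segment[OF assms(2)] assms(3-) by auto
  moreover have "Im z = (Re z)\<^sup>2"
    using parabola_segment(3)[OF assms(1)] assms(3) calculation by simp
  ultimately have "z = parabola b"
    by (simp add: complex_eq_iff)
  then show ?thesis using \<open>b = c\<close> by auto
qed

text \<open>The vertices are drawn on a parabola, with straight edges; the drawing lies above each tangent.\<close>

lemma outerplanar_if_noncrossing:
  fixes V :: "nat set"
  assumes edges: "\<And>e. e \<in> E \<Longrightarrow> \<exists>a b. e = {a, b} \<and> a < b \<and> a \<in> V \<and> b \<in> V"
    and noncrossing: "\<And>a b c d. {a, b} \<in> E \<Longrightarrow> {c, d} \<in> E \<Longrightarrow> a < b \<Longrightarrow> c < d \<Longrightarrow>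
      b \<le> c \<or> d \<le> a \<or> a \<le> c \<and> d \<le> b \<or> c \<le> a \<and> b \<le> d"
  shows "outerplanar V E"
proof -
  define crv where "crv e = linepath (parabola (Min e)) (parabola (Max e))" for e
  have crv: "crv {a, b} = linepath (parabola a) (parabola b)" if "a < b" for a b
    using that by (simp add: crv_def)
  have "plane_drawing V E parabola crv"
    unfolding plane_drawing_def
  proof (intro conjI ballI impI)
    show "inj_on parabola V" by (simp add: inj_on_def)
  next
    fix e assume "e \<in> E"
    then obtain a b where e: "e = {a, b}" "a < b" "a \<in> V" "b \<in> V"
      using edges by blast
    show "arc (crv e)"
      using e by (simp add: crv)
    show "{pathstart (crv e), pathfinish (crv e)} = parabola ` e"
      using e by (simp add: crv)
    have "k = a \<or> k = b" if "parabola k \<in> closed_segment (parabola a) (parabola b)" for k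
      using parabola_segment[OF that] e(2) by auto
    then show "path_image (crv e) \<inter> parabola ` V = parabola ` e"
      using e by (auto simp: crv)
  next
    fix e e' assume E: "e \<in> E" "e' \<in> E" "e \<noteq> e'"
    obtain a b where e: "e = {a, b}" "a < b" using edges[OF E(1)] by blast
    obtain c d where e': "e' = {c, d}" "c < d" using edges[OF E(2)] by blast
    have "(a, b) \<noteq> (c, d)" using E(3) e e' by auto
    show "path_image (crv e) \<inter> path_image (crv e') \<subseteq> parabola ` (e \<inter> e')"
    proof
      fix z assume "z \<in> path_image (crv e) \<inter> path_image (crv e')"
      then have z: "z \<in> closed_segment (parabola a) (parabola b)"
        "z \<in> closed_segment (parabola c) (parabola d)"
        using e e' by (auto simp: crv)
      have "\<exists>k \<in> {a, b} \<inter> {c, d}. z = parabola k"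
        using noncrossing[of a b c d] E e e' \<open>(a, b) \<noteq> (c, d)\<close>
          parabola_segments_consecutive[OF z] parabola_segments_consecutive[OF z(2,1)]
          parabola_segments_nested[OF z] parabola_segments_nested[OF z(2,1)]
        by (auto simp: Int_commute)
      then show "z \<in> parabola ` (e \<inter> e')"
        unfolding e(1) e'(1) by blast
    qed
  qed
  moreover have "parabola v \<in> frontier (outside (drawing_image V E parabola crv))" if "v \<in> V" for v
  proof -
    let ?D = "drawing_image V E parabola crv"
    \<comment> \<open>The closed half-plane above the tangent to the parabola at
      \<open>parabola v\<close>.\<close>
    define T where "T = {z. inner (Complex (- 2 * real v) 1) z \<ge> - ((real v)\<^sup>2)}"
    have T: "z \<in> T \<longleftrightarrow> 2 * real v * Re z - (real v)\<^sup>2 \<le> Im z" for z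
      by (auto simp: T_def inner_complex_def)
    have above: "(Re z)\<^sup>2 \<le> Im z" if z: "z \<in> ?D" for z
    proof -
      consider k where "z = parabola k" | e where "e \<in> E" "z \<in> path_image (crv e)"
        using z by (auto simp: drawing_image_def)
      then show ?thesis
      proof cases
        case 2
        then obtain a b where ab: "e = {a, b}" "a < b" using edges by blast
        then have "z \<in> closed_segment (parabola a) (parabola b)"
          using 2 by (simp add: crv)
        note parabola_segment[OF this]
        then have "Im z - (Re z)\<^sup>2 \<ge> 0" using ab(2) by simp
        then show ?thesis by simp
      qed simp
    qed
    have "?D \<subseteq> T"
    proof
      fix z assume "z \<in> ?D"
      then have "(Re z)\<^sup>2 \<le> Im z" by (rule above)
      moreover have "0 \<le> (Re z - real v)\<^sup>2" by simp
      ultimately show "z \<in> T" unfolding T by (simp add: power2_diff mult_ac)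
    qed
    \<comment> \<open>From a point outside a convex set some ray avoids the set, so everything below
      the tangent belongs to the outer face.\<close>
    then have out: "- T \<subseteq> outside ?D"
      unfolding T_def by (intro outside_subset_convex convex_halfspace_ge)
    have "parabola v \<in> closure (- T)"
      unfolding closure_approachable
    proof (intro allI impI)
      fix \<epsilon> :: real assume "\<epsilon> > 0"
      \<comment> \<open>Points straight below \<open>parabola v\<close> lie under the tangent and
        approach it.\<close>
      then have "Complex (real v) ((real v)\<^sup>2 - \<epsilon> / 2) \<in> - T"
        by (simp add: T power2_eq_square)
      moreover have "dist (Complex (real v) ((real v)\<^sup>2 - \<epsilon> / 2)) (parabola v) < \<epsilon>"
        using \<open>\<epsilon> > 0\<close> by (simp add: dist_norm cmod_def del: real_sqrt_divide power_divide)
      ultimately show "\<exists>y\<in>- T. dist y (parabola v) < \<epsilon>" by blast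
    qed
    then have "parabola v \<in> closure (outside ?D)"
      using closure_mono[OF out] by blast
    moreover have "parabola v \<in> ?D"
      using that by (simp add: drawing_image_def)
    then have "parabola v \<notin> outside ?D"
      using outside_no_overlap[of ?D] by blast
    ultimately show ?thesis
      using interior_subset by (auto simp: frontier_def)
  qed
  ultimately show ?thesis
    unfolding outerplanar_def by blast
qed

lemma outerplanar_ring:
  assumes "n \<ge> 2"
  shows "outerplanar {..<3 * n} (ring_edges n)"
proof (rule outerplanar_if_noncrossing)
  fix e assume "e \<in> ring_edges n"
  then consider k where "e = {k, Suc k}" "k < 3 * n - 1" | i where "e = {3 * i, 3 * i + 2}" "i < n"
    | "e = {0, 3 * n - 1}"
    by (auto simp: ring_edges_def rim_def chord_def closing_def)
  then show "\<exists>a b. e = {a, b} \<and> a < b \<and> a \<in> {..<3 * n} \<and> b \<in> {..<3 * n}"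
  proof cases
    case (1 k)
    then show ?thesis by (intro exI[of _ k] exI[of _ "Suc k"]) auto
  next
    case (2 i)
    then show ?thesis by (intro exI[of _ "3 * i"] exI[of _ "3 * i + 2"]) auto
  next
    case 3
    then show ?thesis using assms by (intro exI[of _ 0] exI[of _ "3 * n - 1"]) auto
  qed
next
  have form: "b = Suc a \<and> b < 3 * n \<or> (\<exists>i<n. a = 3 * i \<and> b = 3 * i + 2) \<or> a = 0 \<and> b = 3 * n - 1"
    if "{a, b} \<in> ring_edges n" "a < b" for a b
    using that by (auto simp: ring_edges_def rim_def chord_def closing_def doubleton_eq_iff)
  fix a b c d assume "{a, b} \<in> ring_edges n" "{c, d} \<in> ring_edges n" "a < b" "c < d"
  from form[OF this(1,3)] form[OF this(2,4)] \<open>a < b\<close> \<open>c < d\<close>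
  show "b \<le> c \<or> d \<le> a \<or> a \<le> c \<and> d \<le> b \<or> c \<le> a \<and> b \<le> d"
  proof (elim disjE exE conjE)
    \<comment> \<open>Two chords: different triples are disjoint intervals, equal ones give the same
      chord.\<close>
    fix i j assume "a = 3 * i" "b = 3 * i + 2" "c = 3 * j" "d = 3 * j + 2"
    then show ?thesis by (cases i j rule: linorder_cases) auto
  qed linarith+
qed

section \<open>Machines and encodings\<close>

text \<open>A step changes only the cell under the head. Finiteness is carried along so that
  \<open>card\<close> is meaningful.\<close>

lemma nonblank_cells:
  assumes "(step M ^^ t) (init_config w) = (q, h, T)"
  shows "finite {i. T i \<noteq> Blank} \<and> card {i. T i \<noteq> Blank} \<le> length w + t"
  using assms
proof (induction t arbitrary: q h T)
  case 0
  then have "{i. T i \<noteq> Blank} \<subseteq> int ` {..<length w}"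
    by (auto simp: init_config_def image_iff split: if_splits intro!: bexI[of _ "nat _"])
  moreover have "card (int ` {..<length w}) = length w" "finite (int ` {..<length w})"
    by (simp_all add: card_image)
  ultimately show ?case
    using card_mono[of "int ` {..<length w}" "{i. T i \<noteq> Blank}"]
      finite_subset[of "{i. T i \<noteq> Blank}" "int ` {..<length w}"] by simp
next
  case (Suc t)
  obtain q0 h0 T0 where c: "(step M ^^ t) (init_config w) = (q0, h0, T0)"
    using prod_cases3 by blast
  note IH = Suc.IH[OF c]
  have "step M (q0, h0, T0) = (q, h, T)"
    using Suc.prems c by simp
  then have sub: "{i. T i \<noteq> Blank} \<subseteq> insert h0 {i. T0 i \<noteq> Blank}"
    by (auto split: option.splits if_splits)
  have "card {i. T i \<noteq> Blank} \<le> card (insert h0 {i. T0 i \<noteq> Blank})"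
    using sub IH by (intro card_mono) auto
  also have "\<dots> \<le> Suc (card {i. T0 i \<noteq> Blank})"
    by (rule card_insert_le_m1) simp_all
  finally show ?case
    using sub IH finite_subset by fastforce
qed

lemma output_length_le:
  assumes "outputs_within M w t w'"
  shows "length w' \<le> length w + t"
proof -
  obtain q h T where c: "(step M ^^ t) (init_config w) = (q, h, T)"
    using prod_cases3 by blast
  have "T (int i) \<noteq> Blank" if "i < length w'" for i
    using assms c that by (auto simp: outputs_within_def dest: nth_mem)
  then have "int ` {..<length w'} \<subseteq> {i. T i \<noteq> Blank}"
    by auto
  then have "card (int ` {..<length w'}) \<le> card {i. T i \<noteq> Blank}"
    using nonblank_cells[OF c] by (intro card_mono) auto
  then show ?thesis
    using nonblank_cells[OF c] by (simp add: card_image)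
qed

section \<open>Lengths of encodings\<close>

lemma length_enc_vectors_ge: "length ys \<le> length (enc_vectors ys)"
  by (induction ys) (auto simp: enc_vectors_def)

lemma length_enc_nat_le: "0 < k \<Longrightarrow> m < 2 ^ k \<Longrightarrow> length (enc_nat m) \<le> k"
proof (induction k arbitrary: m)
  case (Suc k)
  show ?case
  proof (cases "m < 2")
    case False
    then have "k > 0" using Suc.prems by (cases k) auto
    moreover have "m div 2 < 2 ^ k" using Suc.prems by auto
    ultimately show ?thesis
      using Suc.IH False by (subst enc_nat.simps) auto
  qed (simp add: enc_nat.simps)
qed simp

lemma length_concat_le:
  assumes "\<And>xs. xs \<in> set xss \<Longrightarrow> length xs \<le> b"
  shows "length (concat xss) \<le> length xss * b"
  using assms
proof (induction xss)
  case (Cons xs xss)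
  then have "length xs \<le> b" "length (concat xss) \<le> length xss * b" by auto
  then show ?case by simp
qed simp

text \<open>The summands count the vertex list, one separator, and at most N * N edge entries of
  four numbers with at most N digits and four separators each. Nonnegative costs need no minus
  sign.\<close>

lemma instance_size_le:
  assumes "verts I = {..<N}" "N > 0"
    and "\<And>u v. u < N \<Longrightarrow> v < N \<Longrightarrow> u < v \<Longrightarrow> {u, v} \<in> edges I \<Longrightarrow>
      0 \<le> cost1 I {u, v} \<and> cost1 I {u, v} < 2 ^ N \<and> cost2 I {u, v} < 2 ^ N"
  shows "instance_size I \<le> N * (N + 1) + 1 + N * (N * (4 * N + 4))"
proof -
  have vs: "sorted_list_of_set (verts I) = [0..<N]"
    using assms(1) sorted_list_of_set_range[of 0 N] by (simp add: atLeast0LessThan)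
  have vertex: "length (enc_nat u) \<le> N" if "u < N" for u
    using assms(2) order.strict_trans[OF that less_exp] by (rule length_enc_nat_le)
  have "length (enc_int (cost1 I {u, v})) \<le> N \<and> length (enc_nat (cost2 I {u, v})) \<le> N"
    if "u < N" "v < N" "u < v" "{u, v} \<in> edges I" for u v
  proof -
    have "nat \<bar>cost1 I {u, v}\<bar> < 2 ^ N"
      using assms(3)[OF that] by (simp add: nat_less_iff)
    then show ?thesis
      using assms(3)[OF that] assms(2) by (auto simp: enc_int_def intro!: length_enc_nat_le)
  qed
  note cost = this
  define entry where "entry u v = enc_nat u @ [Comma] @ enc_nat v @ [Comma] @ enc_int (cost1 I {u, v}) @ [Comma] @
         enc_nat (cost2 I {u, v}) @ [Semicolon]" for u v
  have entry: "length (entry u v) \<le> 4 * N + 4" if "u < N" "v < N" "u < v" "{u, v} \<in> edges I" for u v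
    using vertex[OF that(1)] vertex[OF that(2)] cost[OF that] by (simp add: entry_def)
  \<comment> \<open>\<open>row\<close> and \<open>entry\<close> mirror the form into which the list
    comprehension in \<open>enc_instance\<close> unfolds, hence the nested
    \<open>concat\<close>.\<close>
  define row where "row u = concat (map (\<lambda>v. if u < v \<and> {u, v} \<in> edges I then [entry u v] else []) [0..<N])" for u
  have row: "length (row u) \<le> N" for u
  proof -
    have "length (row u) \<le> length (map (\<lambda>v. if u < v \<and> {u, v} \<in> edges I then [entry u v] else []) [0..<N]) * 1"
      unfolding row_def by (rule length_concat_le) (auto split: if_splits)
    then show ?thesis by simp
  qed
  have rows: "length (concat (map row [0..<N])) \<le> N * N"
    using length_concat_le[of "map row [0..<N]" N] row by auto
  have "length (concat (concat (map row [0..<N]))) \<le> length (concat (map row [0..<N])) * (4 * N + 4)"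
    by (rule length_concat_le) (auto simp: row_def entry split: if_splits)
  also have "\<dots> \<le> N * N * (4 * N + 4)"
    using rows by (rule mult_right_mono) simp
  finally have edges: "length (concat (concat (map row [0..<N]))) \<le> N * N * (4 * N + 4)" .
  have vertices: "length (concat (map (\<lambda>v. enc_nat v @ [Comma]) [0..<N])) \<le> N * (N + 1)"
  proof -
    have "length (concat (map (\<lambda>v. enc_nat v @ [Comma]) [0..<N]))
        \<le> length (map (\<lambda>v. enc_nat v @ [Comma]) [0..<N]) * (N + 1)"
      by (rule length_concat_le) (auto simp: vertex)
    then show ?thesis by simp
  qed
  have "enc_instance I = concat (map (\<lambda>v. enc_nat v @ [Comma]) [0..<N]) @ [Semicolon] @
      concat (concat (map row [0..<N]))"
    unfolding enc_instance_def vs Let_def row_def entry_def by simp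
  then show ?thesis
    using vertices edges by (simp add: instance_size_def mult.assoc)
qed

lemma instance_size_ring_le:
  assumes "n \<ge> 2"
  shows "instance_size (ring n) \<le> poly [:1, 3, 45, 108:] n"
proof -
  have "ring_cost n {u, v} < 2 ^ (3 * n) \<and> ring_length n {u, v} < 2 ^ (3 * n)"
    if "u < 3 * n" for u v
  proof -
    define j where "j = Min {u, v} div 3"
    have "Min {u, v} < 3 * n" using that by (simp add: min_less_iff_disj)
    then have "j < n" unfolding j_def by linarith
    then have "(2::nat) ^ Suc j \<le> 2 ^ n" "(2::int) ^ j \<le> 2 ^ n"
      by (intro power_increasing; simp)+
    moreover have "(2::nat) ^ n < 2 ^ (3 * n)" "(2::int) ^ n < 2 ^ (3 * n)" "1 < (2::nat) ^ (3 * n)"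
      using assms one_less_power[of "2::nat" "3 * n"] by simp_all
    ultimately show ?thesis
      unfolding ring_cost_def ring_length_def j_def[symmetric] by (auto intro: order.strict_trans1)
  qed
  then have "instance_size (ring n) \<le> 3 * n * (3 * n + 1) + 1 + 3 * n * (3 * n * (4 * (3 * n) + 4))"
    using assms by (intro instance_size_le) (auto simp: ring_cost_nonneg)
  also have "\<dots> = poly [:1, 3, 45, 108:] n"
    by (simp add: algebra_simps)
  finally show ?thesis .
qed

section \<open>Polynomial against exponential growth\<close>

lemma poly_nat_mono:
  fixes p :: "nat poly"
  shows "x \<le> y \<Longrightarrow> poly p x \<le> poly p y"
  by (induction p) (auto intro: add_mono mult_mono)

text \<open>Each induction step splits x^n into two powers of sqrt x: one absorbs the new factor n,
  the other goes to the induction hypothesis. This is why \<open>x\<close> is arbitrary.\<close>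

lemma poly_times_geometric_tendsto_0:
  fixes p :: "nat poly" and x :: real
  assumes "0 \<le> x" "x < 1"
  shows "(\<lambda>n. real (poly p n) * x ^ n) \<longlonglongrightarrow> 0"
  using assms
proof (induction p arbitrary: x)
  case (pCons a p)
  define y where "y = sqrt x"
  have y: "0 \<le> y" "y < 1" "x = y * y"
    using pCons.prems by (auto simp: y_def)
  have "(\<lambda>n. real a * x ^ n + (of_nat n * y ^ n) * (real (poly p n) * y ^ n)) \<longlonglongrightarrow> real a * 0 + 0 * 0"
    using pCons.prems y(1,2)
    by (intro tendsto_intros LIMSEQ_power_zero powser_times_n_limit_0 pCons.IH) auto
  then show ?case
    by (simp add: y(3) power_mult_distrib algebra_simps)
qed simp

lemma poly_less_power_of_2:
  fixes p :: "nat poly"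
  shows "\<exists>n\<ge>k. poly p n < 2 ^ n"
proof -
  have "(\<lambda>n. real (poly p n) * (1 / 2) ^ n) \<longlonglongrightarrow> 0"
    by (rule poly_times_geometric_tendsto_0) auto
  then have "\<forall>\<^sub>F n in sequentially. real (poly p n) * (1 / 2) ^ n < 1"
    by (rule order_tendstoD) simp
  then obtain m where "\<forall>n\<ge>m. real (poly p n) * (1 / 2) ^ n < 1"
    by (auto simp: eventually_sequentially)
  then have "real (poly p (max k m)) * (1 / 2) ^ max k m < 1"
    by simp
  then have "real (poly p (max k m)) < real (2 ^ max k m)"
    by (simp add: power_divide divide_simps)
  then have "poly p (max k m) < 2 ^ max k m"
    by (simp only: of_nat_less_iff)
  then show ?thesis
    by (intro exI[of _ "max k m"]) simp
qed

theorem theorem1: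
  "\<not> (\<exists>(M :: tm) (p :: nat poly). turing_machine M \<and>
     (\<forall>I :: nat msp. msp_instance I \<and> degree_bounded 3 (verts I) (edges I) \<and>
        outerplanar (verts I) (edges I) \<longrightarrow>
        solves_within M I (poly p (instance_size I))))"
proof
  assume "\<exists>(M :: tm) (p :: nat poly). turing_machine M \<and>
     (\<forall>I :: nat msp. msp_instance I \<and> degree_bounded 3 (verts I) (edges I) \<and>
        outerplanar (verts I) (edges I) \<longrightarrow>
        solves_within M I (poly p (instance_size I)))"
  then obtain M :: tm and p :: "nat poly" where
    solves: "\<And>I :: nat msp. msp_instance I \<Longrightarrow> degree_bounded 3 (verts I) (edges I) \<Longrightarrow>
        outerplanar (verts I) (edges I) \<Longrightarrow> solves_within M I (poly p (instance_size I))"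
    by blast
  let ?q = "[:1, 3, 45, 108:] :: nat poly"
  \<comment> \<open>The left side bounds input length plus running time, hence the length of the
    output.\<close>
  obtain n where n: "n \<ge> 2" "poly (?q + pcompose p ?q) n < 2 ^ n"
    using poly_less_power_of_2 by blast
  let ?s = "instance_size (ring n)"
  have "solves_within M (ring n) (poly p ?s)"
    using msp_instance_ring[OF n(1)] degree_bounded_ring[OF n(1)] outerplanar_ring[OF n(1)]
    by (intro solves) simp_all
  then obtain ys where ys: "lists_vectors ys (nondominated_set (ring n))"
    and out: "outputs_within M (enc_instance (ring n)) (poly p ?s) (enc_vectors ys)"
    by (auto simp: solves_within_def)
  let ?f = "\<lambda>(a, n, d). (a, of_nat n / of_nat d) :: int \<times> rat"
  \<comment> \<open>The list may repeat values, also as different fractions, so distinct values are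
    counted through the image.\<close>
  have "2 ^ n \<le> card (?f ` set ys)"
    using nondominated_ring_many[OF n(1), of "?f ` set ys"] ys by (simp add: lists_vectors_def)
  also have "\<dots> \<le> length ys"
    using card_image_le[of "set ys" ?f] card_length[of ys] by simp
  also have "\<dots> \<le> length (enc_vectors ys)"
    by (rule length_enc_vectors_ge)
  also have "\<dots> \<le> ?s + poly p ?s"
    using output_length_le[OF out] by (simp add: instance_size_def)
  also have "\<dots> \<le> poly ?q n + poly p (poly ?q n)"
    using instance_size_ring_le[OF n(1)] by (intro add_mono poly_nat_mono)
  also have "\<dots> = poly (?q + pcompose p ?q) n"
    by (simp only: poly_add poly_pcompose)
  finally show False
    using n(2) by simp
qed

end
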